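(* For every integer $n\ge 3$ we have $a_n<b_n$. Furthermore, the stopping rule $$\tau_{3,n}=\min\{a_n\le j\le n: X_j=2\}\wedge\min\{b_n\le j\le n: X_j=3\}$$ maximizes the probability of selecting the 3rd best of the $n$ candidates, i.e. $P(R_{\tau_{3,n}}=3)=\sup_{\tau\in\mathcal{M}_n}P(R_\tau=3)$.
   Context: Setting: $(R_1,\dots,R_n)$ is a uniformly random permutation of $(1,2,\dots,n)$ ($R_j$ is the absolute rank of the $j$-th candidate, rank 1 being the best), and $X_j=|\{1\le i\le j: R_i\le R_j\}|$ is the relative rank of the $j$-th candidate among the first $j$. $\mathcal{F}_j$ is the $\sigma$-algebra generated by $X_1,\dots,X_j$, and $\mathcal{M}_n$ is the set of all stopping rules with values in $\{1,\dots,n\}$ adapted to $\{\mathcal{F}_j\}$. Conventions: $\min\emptyset:=n$ in the definition of stopping rules; $x\wedge y:=\min\{x,y\}$; $\sum_{i=\ell}^m c_i:=0$ whenever $\ell>m$. For $n\ge 3$ define $$b_n=\min\Big\{j\in\{2,3,\dots,n\}:\ \sum_{i=j+1}^n\frac{1}{i-2}\le\frac12\Big\},\qquad u_n=(b_n-2)(2n-4)\sum_{i=b_n}^n\frac{1}{i-2},$$ $$f_n(x)=3x^2-(1+4n)x+(n-2)b_n+2(n+1)+u_n,\qquad a_n=\min\{j\in\{2,3,\dots,n\}:\ f_n(j)\le 0\}.$$ (The set defining $a_n$ is nonempty for every $n\ge3$, so $a_n$ is well defined.) *)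

theory Defs
  imports "HOL-Probability.Probability"
begin

definition uniform_random_permutation ::
    "'a measure \<Rightarrow> nat \<Rightarrow> (nat \<Rightarrow> 'a \<Rightarrow> nat) \<Rightarrow> bool" where
  "uniform_random_permutation M n R \<longleftrightarrow>
     prob_space M \<and>
     (\<forall>j\<in>{1..n}. R j \<in> measurable M (count_space UNIV)) \<and>
     (\<forall>p. p permutes {1..n} \<longrightarrow>
        measure M {\<omega> \<in> space M. \<forall>j\<in>{1..n}. R j \<omega> = p j} = 1 / fact n)"

definition rel_rank :: "(nat \<Rightarrow> 'a \<Rightarrow> nat) \<Rightarrow> nat \<Rightarrow> 'a \<Rightarrow> nat" where
  "rel_rank R j \<omega> = card {i \<in> {1..j}. R i \<omega> \<le> R j \<omega>}"

(* The sigma-algebra generated by X 1, ..., X j. Only the space and the sets of this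
   measure are meaningful, as usual for filtrations in the library. *)
definition generated_filtration ::
    "'a measure \<Rightarrow> (nat \<Rightarrow> 'a \<Rightarrow> nat) \<Rightarrow> nat \<Rightarrow> 'a measure" where
  "generated_filtration M X j =
     sigma (space M) (\<Union>i\<in>{1..j}. {X i -` A \<inter> space M | A. A \<in> UNIV})"

definition stopping_rules ::
    "'a measure \<Rightarrow> nat \<Rightarrow> (nat \<Rightarrow> 'a \<Rightarrow> nat) \<Rightarrow> ('a \<Rightarrow> nat) set" where
  "stopping_rules M n R =
     {\<tau>. (\<forall>\<omega>\<in>space M. \<tau> \<omega> \<in> {1..n}) \<and>
          stopping_time (generated_filtration M (rel_rank R)) \<tau>}"

(* Minimum with the convention that the minimum of the empty set is n. *)
definition min_or :: "nat \<Rightarrow> nat set \<Rightarrow> nat" where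
  "min_or n S = (if S = {} then n else Min S)"

(* The set contains n, and does not contain 2 when n \<ge> 3, so the threshold is at
   least 3 and no denominator in u_term below vanishes. *)
definition b_threshold :: "nat \<Rightarrow> nat" where
  "b_threshold n = Min {j \<in> {2..n}. (\<Sum>i = j + 1..n. 1 / (real i - 2)) \<le> 1 / 2}"

definition u_term :: "nat \<Rightarrow> real" where
  "u_term n = (real (b_threshold n) - 2) * (2 * real n - 4) *
     (\<Sum>i = b_threshold n..n. 1 / (real i - 2))"

definition f_poly :: "nat \<Rightarrow> real \<Rightarrow> real" where
  "f_poly n x = 3 * x\<^sup>2 - (1 + 4 * real n) * x
     + (real n - 2) * real (b_threshold n) + 2 * (real n + 1) + u_term n"

(* For n \<ge> 3 the set is nonempty. *)
definition a_threshold :: "nat \<Rightarrow> nat" where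
  "a_threshold n = Min {j \<in> {2..n}. f_poly n (real j) \<le> 0}"

definition tau3 :: "nat \<Rightarrow> (nat \<Rightarrow> 'a \<Rightarrow> nat) \<Rightarrow> 'a \<Rightarrow> nat" where
  "tau3 n R \<omega> =
     min (min_or n {j \<in> {a_threshold n..n}. rel_rank R j \<omega> = 2})
         (min_or n {j \<in> {b_threshold n..n}. rel_rank R j \<omega> = 3})"

definition prob_select_third ::
    "'a measure \<Rightarrow> (nat \<Rightarrow> 'a \<Rightarrow> nat) \<Rightarrow> ('a \<Rightarrow> nat) \<Rightarrow> real" where
  "prob_select_third M R \<tau> = measure M {\<omega> \<in> space M. R (\<tau> \<omega>) \<omega> = 3}"

end

theory Submission
  imports Defs
begin

text \<open>
  The relative ranks are independent with \<open>X j\<close> uniform on \<open>{1..j}\<close>, and the rank of candidate \<open>j\<close>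
  among the first \<open>i\<close> evolves with \<open>i\<close> as a deterministic function of \<open>X j, \<dots>, X i\<close>.  Hence
  \<open>P (R j = 3 | X 1, \<dots>, X j)\<close> depends on \<open>X j\<close> only, and the problem is solved
  by backward induction.
  Multiplying all probabilities by \<open>n (n - 1) (n - 2)\<close>, the value \<open>v j\<close> of continuing after time \<open>j\<close>
  becomes explicit: \<open>v j / (j (j - 1))\<close> telescopes where ranks 2 and 3 are accepted, \<open>v j / j\<close>
  telescopes where only rank 2 is accepted, and \<open>v\<close> is constant before.  Comparing with the rewards,
  accepting rank 3 at \<open>j\<close> is optimal iff the tail sum in the definition of \<open>b\<close> is at most 1/2, and
  accepting rank 2 at \<open>j < b\<close> is optimal iff \<open>f j \<le> 0\<close>.
\<close>

section \<open>The dynamic programming equation\<close>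

definition tail_sum :: "nat \<Rightarrow> nat \<Rightarrow> real" where
  "tail_sum n j = (\<Sum>i = j + 1..n. 1 / (real i - 2))"

text \<open>\<open>reward n j k\<close> is \<open>n (n - 1) (n - 2) P (R j = 3 | X j = k)\<close>.\<close>
definition reward :: "nat \<Rightarrow> nat \<Rightarrow> nat \<Rightarrow> real" where
  "reward n j k =
     (if k = 1 then real j * (real n - real j) * (real n - real j - 1)
      else if k = 2 then 2 * real j * (real j - 1) * (real n - real j)
      else if k = 3 then real j * (real j - 1) * (real j - 2)
      else 0)"

definition stop3 :: "nat \<Rightarrow> nat \<Rightarrow> nat \<Rightarrow> bool" where
  "stop3 n j k \<longleftrightarrow> a_threshold n \<le> j \<and> k = 2 \<or> b_threshold n \<le> j \<and> k = 3"

text \<open>Continuation value divided by \<open>j * (j - 1)\<close> while ranks 2 and 3 are both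
  accepted. Each step back adds \<open>(2 * n - 4) / (j - 1) - 1\<close>, starting from 0 at
  \<open>n\<close>.\<close>

definition late_value :: "nat \<Rightarrow> nat \<Rightarrow> real" where
  "late_value n j = (2 * real n - 4) * tail_sum n j - (real n - real j)"

text \<open>Continuation value divided by \<open>j\<close> while only rank 2 is accepted. The steps
  \<open>2 * (n - j - 1)\<close> give the quadratic part; the constant is fixed by agreement with
  \<open>late_value\<close> at \<open>b - 1\<close>.\<close>

definition mid_value :: "nat \<Rightarrow> nat \<Rightarrow> real" where
  "mid_value n j = u_term n + (real j)\<^sup>2 + (1 - 2 * real n) * real j
     + (real n - 2) * real (b_threshold n) + 2"

text \<open>The value of continuing after time \<open>j\<close>, on the scale of \<^const>\<open>reward\<close>.\<close>
definition opt_value :: "nat \<Rightarrow> nat \<Rightarrow> real" where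
  "opt_value n j =
     (if b_threshold n \<le> Suc j then real j * (real j - 1) * late_value n j
      else let i = max j (a_threshold n - 1) in real i * mid_value n i)"

section \<open>Bounds on the tail sum\<close>

lemma tail_sum_Suc:
  assumes "j < n"
  shows "tail_sum n j = tail_sum n (Suc j) + 1 / (real j - 1)"
  using assms by (simp add: tail_sum_def sum.atLeast_Suc_atMost)

lemma tail_sum_nonneg: "1 \<le> j \<Longrightarrow> 0 \<le> tail_sum n j"
  unfolding tail_sum_def by (intro sum_nonneg) auto

lemma tail_sum_antimono:
  assumes "2 \<le> i" "i \<le> j"
  shows "tail_sum n j \<le> tail_sum n i"
  unfolding tail_sum_def using assms by (intro sum_mono2) auto

lemma tail_sum_upper:
  assumes "2 \<le> j" "j \<le> n"
  shows "(real j - 1) * tail_sum n j \<le> real n - real j"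
proof -
  have "tail_sum n j \<le> real (card {j + 1..n}) * (1 / (real j - 1))"
    unfolding tail_sum_def using assms
    by (intro sum_bounded_above) (auto intro!: divide_left_mono)
  then show ?thesis using assms by (simp add: field_simps of_nat_diff)
qed

lemma tail_sum_lower:
  assumes "2 \<le> j" "j \<le> n" "3 \<le> n"
  shows "real n - real j \<le> (real n - 2) * tail_sum n j"
proof -
  have "real (card {j + 1..n}) * (1 / (real n - 2)) \<le> tail_sum n j"
    unfolding tail_sum_def using assms
    by (intro sum_bounded_below) (auto intro!: divide_left_mono)
  then show ?thesis using assms by (simp add: field_simps of_nat_diff)
qed

context
  fixes n :: nat
  assumes n3: "3 \<le> n"
begin

section \<open>Existence and location of the threshold \<open>b\<close>\<close>

lemma b_threshold_props:
  shows b_threshold_le: "b_threshold n \<le> n" and b_threshold_ge: "3 \<le> b_threshold n"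
    and tail_sum_b_threshold: "tail_sum n (b_threshold n) \<le> 1 / 2"
    and b_threshold_least: "\<And>j. 2 \<le> j \<Longrightarrow> j < b_threshold n \<Longrightarrow> 1 / 2 < tail_sum n j"
proof -
  let ?A = "{j \<in> {2..n}. (\<Sum>i = j + 1..n. 1 / (real i - 2)) \<le> 1 / 2}"
  have finite_A: "finite ?A" by simp
  have "n \<in> ?A" using n3 by auto
  then have in_A: "b_threshold n \<in> ?A"
    unfolding b_threshold_def using Min_in[OF finite_A] by blast
  then show "b_threshold n \<le> n" "tail_sum n (b_threshold n) \<le> 1 / 2" by (auto simp: tail_sum_def)
  show least: "1 / 2 < tail_sum n j" if "2 \<le> j" "j < b_threshold n" for j
  proof (rule ccontr)
    assume "\<not> 1 / 2 < tail_sum n j"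
    with that \<open>b_threshold n \<le> n\<close> have "j \<in> ?A" by (auto simp: tail_sum_def)
    then have "b_threshold n \<le> j" unfolding b_threshold_def by (intro Min_le) auto
    with that show False by simp
  qed
  \<comment> \<open>The index 2 fails: each of the \<open>n - 2\<close> terms of the sum is at least
    \<open>1 / (n - 2)\<close>.\<close>
  have "real n - 2 \<le> (real n - 2) * tail_sum n 2"
    using tail_sum_lower[of 2 n] n3 by simp
  then have "1 \<le> tail_sum n 2" using n3 by simp
  with \<open>tail_sum n (b_threshold n) \<le> 1 / 2\<close> have "b_threshold n \<noteq> 2" by auto
  with in_A show "3 \<le> b_threshold n" by auto
qed

text \<open>The \<open>n - b\<close> tail terms are each at least \<open>1 / (n - 2)\<close>, yet
  sum to at most 1/2. Used below in the form \<open>n - 2 \<le> 2 * (b - 2)\<close>.\<close>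

lemma b_threshold_lower: "n + 2 \<le> 2 * b_threshold n"
proof -
  have "real n - real (b_threshold n) \<le> (real n - 2) * tail_sum n (b_threshold n)"
    using tail_sum_lower b_threshold_le b_threshold_ge n3 by simp
  also have "\<dots> \<le> (real n - 2) * (1 / 2)"
    using tail_sum_b_threshold n3 by (intro mult_left_mono) auto
  finally have "real n + 2 \<le> 2 * real (b_threshold n)" by simp
  then show ?thesis by linarith
qed

lemma tail_sum_pred_b_threshold:
  "tail_sum n (b_threshold n - 1)
      = tail_sum n (b_threshold n) + 1 / (real (b_threshold n) - 2)"
  using tail_sum_Suc[of "b_threshold n - 1" n] b_threshold_ge b_threshold_le
  by (simp add: of_nat_diff)

section \<open>Late values against the rewards of ranks 1, 2 and 3\<close>

lemma late_le_second:
  assumes "b_threshold n \<le> Suc j" "j \<le> n"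
  shows "late_value n j \<le> 2 * (real n - real j)"
proof -
  have j2: "2 \<le> j" using assms b_threshold_ge by simp
  \<comment> \<open>An equivalent form of the claim. For large \<open>j\<close> the termwise bound
    \<open>tail_sum_upper\<close> suffices; for small \<open>j\<close> the tail is at most
    \<open>1 / 2 + 1 / (b - 2)\<close>, because \<open>j \<ge> b - 1\<close>.\<close>
  have "(2 * real n - 4) * tail_sum n j \<le> 3 * (real n - real j)"
  proof (cases "2 * n \<le> 3 * j + 1")
    case True
    then have "(2 * real n - 4) * tail_sum n j \<le> (3 * (real j - 1)) * tail_sum n j"
      using tail_sum_nonneg[of j n] j2 by (intro mult_right_mono) auto
    also have "\<dots> \<le> 3 * (real n - real j)"
      using tail_sum_upper[of j n] j2 assms by (simp add: algebra_simps)
    finally show ?thesis .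
  next
    case False
    have "tail_sum n j \<le> tail_sum n (b_threshold n - 1)"
      using assms b_threshold_ge by (intro tail_sum_antimono) auto
    also have "\<dots> \<le> 1 / 2 + 1 / (real (b_threshold n) - 2)"
      using tail_sum_pred_b_threshold tail_sum_b_threshold by simp
    finally have "(2 * real n - 4) * tail_sum n j
          \<le> (2 * real n - 4) * (1 / 2 + 1 / (real (b_threshold n) - 2))"
      using n3 by (intro mult_left_mono) auto
    also have "\<dots> = real n - 2 + (2 * real n - 4) / (real (b_threshold n) - 2)"
      by (simp add: algebra_simps add_divide_distrib diff_divide_distrib)
    also have "(2 * real n - 4) / (real (b_threshold n) - 2) \<le> 4"
      using b_threshold_lower b_threshold_ge by (simp add: field_simps)
    finally have "(2 * real n - 4) * tail_sum n j \<le> real n + 2" by simp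
    also have "real n + 2 \<le> 3 * (real n - real j)"
    proof -
      have "3 * real j + 2 \<le> 2 * real n" using False by linarith
      then show ?thesis by simp
    qed
    finally show ?thesis .
  qed
  then show ?thesis by (simp add: late_value_def)
qed

text \<open>The left side is the reward of rank 1 divided by \<open>j\<close>. From
  \<open>j \<ge> b - 1\<close> follows \<open>n - 2 \<le> 2 * (j - 1)\<close>, and
  \<open>(n - j) * (n - 2)\<close> splits as
  \<open>(n - j) * (n - j - 1) + (j - 1) * (n - j)\<close>.\<close>

lemma late_ge_first:
  assumes "b_threshold n \<le> Suc j" "j \<le> n"
  shows "(real n - real j) * (real n - real j - 1) \<le> (real j - 1) * late_value n j"
proof -
  have j2: "2 \<le> j" using assms b_threshold_ge by simp
  have "real n - real j \<le> (real n - 2) * tail_sum n j"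
    using tail_sum_lower j2 assms n3 by simp
  also have "\<dots> \<le> (2 * (real j - 1)) * tail_sum n j"
    using tail_sum_nonneg[of j n] j2 b_threshold_lower assms by (intro mult_right_mono) auto
  finally have "(real n - 2) * (real n - real j) \<le> (real n - 2) * (2 * (real j - 1) * tail_sum n j)"
    using n3 by (intro mult_left_mono) auto
  then show ?thesis by (simp add: late_value_def algebra_simps)
qed

text \<open>Source of the constant 1/2: \<open>j - 2\<close> is the reward of rank 3 divided by
  \<open>j * (j - 1)\<close>, and it is at least \<open>late_value n j\<close> exactly when the tail
  sum is at most 1/2.\<close>

lemma late_le_third:
  assumes "b_threshold n \<le> j"
  shows "late_value n j \<le> real j - 2"
proof -
  have "tail_sum n j \<le> 1 / 2"
    using tail_sum_antimono[of "b_threshold n" j n] tail_sum_b_threshold b_threshold_ge assms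
    by simp
  then have "(2 * real n - 4) * tail_sum n j \<le> (2 * real n - 4) * (1 / 2)"
    using n3 by (intro mult_left_mono) auto
  then show ?thesis by (simp add: late_value_def)
qed

lemma late_ge_third: "real (b_threshold n) - 3 \<le> late_value n (b_threshold n - 1)"
proof -
  have "1 / 2 \<le> tail_sum n (b_threshold n - 1)"
    using b_threshold_least[of "b_threshold n - 1"] b_threshold_ge by force
  then have "(2 * real n - 4) * (1 / 2) \<le> (2 * real n - 4) * tail_sum n (b_threshold n - 1)"
    using n3 by (intro mult_left_mono) auto
  then show ?thesis using b_threshold_ge by (simp add: late_value_def of_nat_diff)
qed

section \<open>Recursions for the closed forms, and the threshold \<open>a\<close>\<close>

lemma late_step:
  assumes "2 \<le> j" "j < n"
  shows "(real j - 1) * late_value n j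
        = (real j - 1) * late_value n (Suc j) + (2 * real n - real j - 3)"
  using assms by (simp add: late_value_def tail_sum_Suc field_simps)

text \<open>At \<open>j = b - 1\<close> both closed forms describe the same value, divided by
  \<open>j\<close> and by \<open>j * (j - 1)\<close>. This gluing is the origin of
  \<open>u_term\<close>.\<close>

lemma mid_eq_late:
  "mid_value n (b_threshold n - 1)
      = (real (b_threshold n) - 2) * late_value n (b_threshold n - 1)"
proof -
  have "u_term n = (real (b_threshold n) - 2) * (2 * real n - 4) * tail_sum n (b_threshold n - 1)"
    using b_threshold_ge by (simp add: u_term_def tail_sum_def)
  then show ?thesis using b_threshold_ge
    by (simp add: mid_value_def late_value_def of_nat_diff power2_eq_square algebra_simps)
qed

text \<open>While only rank 2 is accepted, \<open>f_poly\<close> is the continuation value minus the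
  reward of rank 2, both divided by \<open>j\<close>; its sign decides whether rank 2 is
  taken.\<close>

lemma f_poly_eq: "f_poly n (real j) = mid_value n j - 2 * (real j - 1) * (real n - real j)"
  by (simp add: f_poly_def mid_value_def power2_eq_square algebra_simps)

lemma mid_step: "mid_value n j = mid_value n (Suc j) + 2 * (real n - real j - 1)"
  by (simp add: mid_value_def power2_eq_square algebra_simps)

text \<open>At \<open>b - 1\<close> rank 2 is already worth accepting by
  \<open>late_le_second\<close>. This yields both the nonemptiness of the set defining
  \<open>a\<close> and \<open>a < b\<close>.\<close>

lemma f_poly_pred_b_threshold: "f_poly n (real (b_threshold n - 1)) \<le> 0"
proof -
  have "(real (b_threshold n) - 2) * late_value n (b_threshold n - 1)
        \<le> (real (b_threshold n) - 2) * (2 * (real n - real (b_threshold n - 1)))"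
    using late_le_second[of "b_threshold n - 1"] b_threshold_ge b_threshold_le
    by (intro mult_left_mono) auto
  then show ?thesis unfolding f_poly_eq mid_eq_late using b_threshold_ge
    by (simp add: of_nat_diff algebra_simps)
qed

lemma a_threshold_props:
  shows a_threshold_less: "a_threshold n < b_threshold n" and a_threshold_ge: "2 \<le> a_threshold n"
    and f_poly_a_threshold: "f_poly n (real (a_threshold n)) \<le> 0"
    and a_threshold_least: "\<And>j. 2 \<le> j \<Longrightarrow> j < a_threshold n \<Longrightarrow> 0 < f_poly n (real j)"
proof -
  let ?A = "{j \<in> {2..n}. f_poly n (real j) \<le> 0}"
  have finite_A: "finite ?A" by simp
  have b1: "b_threshold n - 1 \<in> ?A"
    using f_poly_pred_b_threshold b_threshold_ge b_threshold_le by auto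
  then have "a_threshold n \<in> ?A" unfolding a_threshold_def using Min_in[OF finite_A] by blast
  then show "2 \<le> a_threshold n" "f_poly n (real (a_threshold n)) \<le> 0" by auto
  have "a_threshold n \<le> b_threshold n - 1" unfolding a_threshold_def using b1 by (intro Min_le) auto
  then show "a_threshold n < b_threshold n" using b_threshold_ge by simp
  show "0 < f_poly n (real j)" if "2 \<le> j" "j < a_threshold n" for j
  proof (rule ccontr)
    assume "\<not> 0 < f_poly n (real j)"
    with that \<open>a_threshold n < b_threshold n\<close> b_threshold_le have "j \<in> ?A" by auto
    then have "a_threshold n \<le> j" unfolding a_threshold_def by (intro Min_le) auto
    with that show False by simp
  qed
qed

text \<open>A convex quadratic that is nonpositive at \<open>a\<close> and at \<open>b - 1\<close>
  is nonpositive in between.\<close>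

lemma f_poly_nonpos:
  assumes "a_threshold n \<le> j" "j < b_threshold n"
  shows "f_poly n (real j) \<le> 0"
proof (cases "a_threshold n = b_threshold n - 1")
  case True
  with assms have "j = a_threshold n" by simp
  then show ?thesis using f_poly_a_threshold by simp
next
  case False
  define A B x where "A = real (a_threshold n)" and "B = real (b_threshold n - 1)" and "x = real j"
  have ord: "A \<le> x" "x \<le> B" "A < B"
    using assms False a_threshold_less by (auto simp: A_def B_def x_def)
  \<comment> \<open>Chord interpolation, exact for leading coefficient 3; the subtracted term is the
    convexity defect.\<close>
  have "(B - A) * f_poly n x =
      (B - x) * f_poly n A + (x - A) * f_poly n B - 3 * (B - A) * ((x - A) * (B - x))"
    by (simp add: f_poly_def power2_eq_square algebra_simps)
  also have "\<dots> \<le> 0"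
  proof -
    have "(B - x) * f_poly n A \<le> 0" "(x - A) * f_poly n B \<le> 0"
      using ord f_poly_a_threshold f_poly_pred_b_threshold
      by (auto simp: A_def B_def intro: mult_nonneg_nonpos)
    moreover have "0 \<le> 3 * (B - A) * ((x - A) * (B - x))" using ord by simp
    ultimately show ?thesis by linarith
  qed
  finally show ?thesis using ord by (simp add: x_def mult_le_0_iff)
qed

text \<open>\<open>(n - j) (n - j - 1)\<close> and \<^const>\<open>mid_value\<close> have the same increments in \<open>j\<close>.\<close>
lemma mid_ge_first_third:
  assumes "j < b_threshold n"
  shows "(real n - real j) * (real n - real j - 1) \<le> mid_value n j"
    and "(real j - 1) * (real j - 2) \<le> mid_value n j \<or> j = 0"
proof -
  have "j \<le> b_threshold n - 1" using assms by simp
  then have "(real n - real j) * (real n - real j - 1) \<le> mid_value n j \<and>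
      ((real j - 1) * (real j - 2) \<le> mid_value n j \<or> j = 0)"
  proof (induction j rule: inc_induct)
    case base
    have "(real (b_threshold n) - 2) * (real (b_threshold n) - 3)
          \<le> (real (b_threshold n) - 2) * late_value n (b_threshold n - 1)"
      using late_ge_third b_threshold_ge by (intro mult_left_mono) auto
    then show ?case
      using late_ge_first[of "b_threshold n - 1"] b_threshold_ge b_threshold_le mid_eq_late
      by (simp add: of_nat_diff)
  next
    case (step j)
    have "real j + 1 \<le> real n" using step b_threshold_le by linarith
    \<comment> \<open>Going down, the gap in the first comparison is constant, while
      \<open>mid_value\<close> does not decrease and \<open>(j - 1) * (j - 2)\<close> does not grow,
      except from 1 to 0; hence the exemption of \<open>j = 0\<close>.\<close>
    with step show ?case by (auto simp: mid_step[of j] algebra_simps)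
  qed
  then show "(real n - real j) * (real n - real j - 1) \<le> mid_value n j"
    "(real j - 1) * (real j - 2) \<le> mid_value n j \<or> j = 0" by auto
qed

text \<open>The tail at \<open>b - 1\<close> exceeds 1/2 although its terms are at most
  \<open>1 / (b - 2)\<close>. The bound makes the reward of rank 2 nondecreasing before
  \<open>a\<close>.\<close>

lemma b_threshold_upper: "3 * b_threshold n \<le> 2 * n + 3"
proof (rule ccontr)
  assume "\<not> ?thesis"
  then have big: "2 * n + 4 \<le> 3 * b_threshold n" by simp
  have "(real (b_threshold n - 1) - 1) * tail_sum n (b_threshold n - 1)
        \<le> real n - real (b_threshold n - 1)"
    using b_threshold_ge b_threshold_le by (intro tail_sum_upper) auto
  moreover have "(real (b_threshold n - 1) - 1) * (1 / 2)
        < (real (b_threshold n - 1) - 1) * tail_sum n (b_threshold n - 1)"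
    using b_threshold_least[of "b_threshold n - 1"] b_threshold_ge
    by (intro mult_strict_left_mono) auto
  ultimately have "(real (b_threshold n - 1) - 1) * (1 / 2) < real n - real (b_threshold n - 1)"
    by linarith
  then show False using big b_threshold_ge by (simp add: of_nat_diff)
qed

section \<open>The value function, and the stage before \<open>a\<close>\<close>

lemma opt_value_late:
  "b_threshold n \<le> Suc j \<Longrightarrow> opt_value n j = real j * (real j - 1) * late_value n j"
  by (simp add: opt_value_def)

text \<open>The range includes \<open>a - 1\<close> and \<open>b - 1\<close>; at the latter the
  definition takes the late branch, which agrees by \<open>mid_eq_late\<close>.\<close>

lemma opt_value_mid:
  assumes "a_threshold n \<le> Suc j" "j < b_threshold n"
  shows "opt_value n j = real j * mid_value n j"
proof (cases "b_threshold n \<le> Suc j")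
  case True
  then have "j = b_threshold n - 1" using assms by simp
  then show ?thesis using mid_eq_late b_threshold_ge by (simp add: opt_value_late of_nat_diff)
next
  case False
  moreover have "max j (a_threshold n - 1) = j" using assms by auto
  ultimately show ?thesis by (simp add: opt_value_def Let_def)
qed

lemma opt_value_early: "j < a_threshold n \<Longrightarrow> opt_value n j = opt_value n (a_threshold n - 1)"
  using a_threshold_less by (simp add: opt_value_def Let_def max_absorb2)

lemma opt_value_pred_a_threshold:
  "opt_value n (a_threshold n - 1) = real (a_threshold n - 1) * mid_value n (a_threshold n - 1)"
  using opt_value_mid[of "a_threshold n - 1"] a_threshold_less by simp

text \<open>The continuation value is constant before \<open>a\<close> and the reward of rank 2 does
  not decrease there, so \<open>j = a - 1\<close> is the critical case.\<close>

lemma reward_second_le_early: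
  assumes "1 \<le> j" "j < a_threshold n"
  shows "reward n j 2 \<le> opt_value n (a_threshold n - 1)"
proof -
  have "j \<le> a_threshold n - 1" using assms by simp
  then show ?thesis using assms(1)
  proof (induction j rule: inc_induct)
    case base
    show ?case
    \<comment> \<open>Minimality of \<open>a\<close> gives the sign of \<open>f_poly\<close> at
      \<open>a - 1\<close> only if \<open>a - 1 \<ge> 2\<close>. If \<open>a = 2\<close>, the reward
      in question is 0.\<close>
    proof (cases "a_threshold n = 2")
      case True
      have "0 \<le> (real n - real 1) * (real n - real 1 - 1)" using n3 by simp
      also have "\<dots> \<le> mid_value n 1" using mid_ge_first_third(1)[of 1] b_threshold_ge by simp
      finally have "0 \<le> mid_value n (a_threshold n - 1)" using True by simp
      then show ?thesis unfolding opt_value_pred_a_threshold using True by (simp add: reward_def)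
    next
      case False
      then have "0 \<le> f_poly n (real (a_threshold n - 1))"
        using a_threshold_least[of "a_threshold n - 1"] a_threshold_ge by force
      then have "real (a_threshold n - 1) * (2 * (real (a_threshold n - 1) - 1) * (real n - real (a_threshold n - 1)))
          \<le> real (a_threshold n - 1) * mid_value n (a_threshold n - 1)"
        by (intro mult_left_mono) (auto simp: f_poly_eq)
      then show ?thesis unfolding opt_value_pred_a_threshold by (simp add: reward_def algebra_simps)
    qed
  next
    case (step j)
    have "0 \<le> 2 * real j * (2 * real n - 3 * real j - 1)"
      using step b_threshold_upper a_threshold_less by (intro mult_nonneg_nonneg) linarith+
    also have "\<dots> = reward n (Suc j) 2 - reward n j 2"
      by (simp add: reward_def algebra_simps)
    finally show ?case using step by simp
  qed
qed

text \<open>The reward of rank 1 grows in \<open>j\<close> while \<open>3 * j + 2 < n\<close>, so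
  there the induction hypothesis applies. Afterwards it is at most the reward of rank 2 at
  \<open>j + 1\<close>, which is already bounded.\<close>

lemma reward_first_le_early:
  assumes "j < a_threshold n"
  shows "reward n j 1 \<le> opt_value n (a_threshold n - 1)"
proof -
  have "j \<le> a_threshold n - 1" using assms by simp
  then show ?thesis
  proof (induction j rule: inc_induct)
    case base
    have "real (a_threshold n - 1) * ((real n - real (a_threshold n - 1)) * (real n - real (a_threshold n - 1) - 1))
        \<le> real (a_threshold n - 1) * mid_value n (a_threshold n - 1)"
      using mid_ge_first_third(1)[of "a_threshold n - 1"] a_threshold_less
      by (intro mult_left_mono) auto
    then show ?case unfolding opt_value_pred_a_threshold by (simp add: reward_def mult_ac)
  next
    case (step j)
    have jn: "real j + 1 \<le> real n" using step a_threshold_less b_threshold_le by linarith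
    show ?case
    proof (cases "n \<le> 3 * j + 2")
      case True
      have "0 \<le> real j * (real n - real j - 1) * (3 * real j + 2 - real n)"
        using True jn by (intro mult_nonneg_nonneg) linarith+
      also have "\<dots> = reward n (Suc j) 2 - reward n j 1"
        by (simp add: reward_def algebra_simps)
      finally have "reward n j 1 \<le> reward n (Suc j) 2" by simp
      moreover have "Suc j < a_threshold n" using step by simp
      ultimately show ?thesis using reward_second_le_early[of "Suc j"] by simp
    next
      case False
      have "0 \<le> (real n - real j - 1) * (real n - 2 - 3 * real j)"
        using False jn by (intro mult_nonneg_nonneg) linarith+
      also have "\<dots> = reward n (Suc j) 1 - reward n j 1"
        by (simp add: reward_def algebra_simps)
      finally show ?thesis using step by simp
    qed
  qed
qed

lemma reward_third_le_early:
  assumes "1 \<le> j" "j < a_threshold n"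
  shows "reward n j 3 \<le> opt_value n (a_threshold n - 1)"
proof -
  have "j \<le> a_threshold n - 1" using assms by simp
  then show ?thesis using assms(1)
  proof (induction j rule: inc_induct)
    case base
    have "real (a_threshold n - 1) * ((real (a_threshold n - 1) - 1) * (real (a_threshold n - 1) - 2))
        \<le> real (a_threshold n - 1) * mid_value n (a_threshold n - 1)"
      using mid_ge_first_third(2)[of "a_threshold n - 1"] a_threshold_less a_threshold_ge
      by (intro mult_left_mono) auto
    then show ?case unfolding opt_value_pred_a_threshold by (simp add: reward_def mult_ac)
  next
    case (step j)
    have "0 \<le> 3 * real j * (real j - 1)" using step by simp
    also have "\<dots> = reward n (Suc j) 3 - reward n j 3"
      by (simp add: reward_def algebra_simps)
    finally show ?case using step by simp
  qed
qed

section \<open>Optimality of \<open>stop3\<close> and the Bellman equation\<close>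

lemma reward_first_le:
  assumes "1 \<le> j" "j \<le> n"
  shows "reward n j 1 \<le> opt_value n j"
proof -
  consider "j < a_threshold n" | "a_threshold n \<le> j" "j < b_threshold n" | "b_threshold n \<le> j"
    by linarith
  then show ?thesis
  proof cases
    case 1
    then show ?thesis using reward_first_le_early opt_value_early[of j] by simp
  next
    case 2
    have "real j * ((real n - real j) * (real n - real j - 1)) \<le> real j * mid_value n j"
      using mid_ge_first_third(1)[of j] 2 by (intro mult_left_mono) auto
    then show ?thesis using 2 opt_value_mid[of j] by (simp add: reward_def mult_ac)
  next
    case 3
    have "real j * ((real n - real j) * (real n - real j - 1))
          \<le> real j * ((real j - 1) * late_value n j)"
      using late_ge_first[of j] 3 assms by (intro mult_left_mono) auto
    then show ?thesis using 3 by (simp add: opt_value_late reward_def mult_ac)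
  qed
qed

lemma opt_value_nonneg:
  assumes "1 \<le> j" "j \<le> n"
  shows "0 \<le> opt_value n j"
proof -
  have "0 \<le> reward n j 1"
  proof (cases "j = n")
    case False
    then have "real j + 1 \<le> real n" using assms by linarith
    then show ?thesis by (simp add: reward_def)
  qed (simp add: reward_def)
  then show ?thesis using reward_first_le[OF assms] by simp
qed

lemma reward_le_opt_value:
  assumes "1 \<le> j" "j \<le> n" "\<not> stop3 n j k"
  shows "reward n j k \<le> opt_value n j"
proof -
  consider "k = 1" | "k = 2" "j < a_threshold n" | "k = 3" "j < a_threshold n"
    | "k = 3" "a_threshold n \<le> j" "j < b_threshold n"
    | "k \<notin> {1,2,3}"
    using assms(3) unfolding stop3_def by force
  then show ?thesis
  proof cases
    case 1
    then show ?thesis using reward_first_le assms by simp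
  next
    case 2
    then show ?thesis using reward_second_le_early[of j] opt_value_early[of j] assms by simp
  next
    case 3
    then show ?thesis using reward_third_le_early[of j] opt_value_early[of j] assms by simp
  next
    case 4
    have "real j * ((real j - 1) * (real j - 2)) \<le> real j * mid_value n j"
      using mid_ge_first_third(2)[of j] 4 assms by (intro mult_left_mono) auto
    then show ?thesis using 4 opt_value_mid[of j] by (simp add: reward_def mult_ac)
  next
    case 5
    then show ?thesis using opt_value_nonneg[of j] assms by (simp add: reward_def)
  qed
qed

lemma opt_value_le_reward:
  assumes "j \<le> n" "stop3 n j k"
  shows "opt_value n j \<le> reward n j k"
proof -
  consider "k = 2" "a_threshold n \<le> j" "j < b_threshold n" | "k = 2" "b_threshold n \<le> j"
    | "k = 3" "b_threshold n \<le> j"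
    using assms(2) unfolding stop3_def by force
  then show ?thesis
  proof cases
    case 1
    have "real j * mid_value n j \<le> real j * (2 * (real j - 1) * (real n - real j))"
      using f_poly_nonpos[of j] 1 by (intro mult_left_mono) (auto simp: f_poly_eq)
    then show ?thesis using 1 opt_value_mid[of j] by (simp add: reward_def mult_ac)
  next
    case 2
    have "real j * (real j - 1) * late_value n j \<le> real j * (real j - 1) * (2 * (real n - real j))"
      using late_le_second[of j] 2 assms b_threshold_ge by (intro mult_left_mono) auto
    then show ?thesis using 2 by (simp add: opt_value_late reward_def algebra_simps)
  next
    case 3
    have "real j * (real j - 1) * late_value n j \<le> real j * (real j - 1) * (real j - 2)"
      using late_le_third[of j] 3 b_threshold_ge by (intro mult_left_mono) auto
    then show ?thesis using 3 by (simp add: opt_value_late reward_def)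
  qed
qed

text \<open>The Bellman equation, each \<open>k\<close> having conditional probability
  \<open>1 / (j + 1)\<close>. The proof isolates the gain over continuing on the accepted ranks:
  none, \<open>{2}\<close> or \<open>{2, 3}\<close>, all attainable since \<open>a \<ge> 2\<close>
  and \<open>b \<ge> 3\<close>.\<close>

lemma opt_value_step:
  assumes "j < n"
  shows "(\<Sum>k = 1..Suc j. if stop3 n (Suc j) k then reward n (Suc j) k else opt_value n (Suc j))
    = real (Suc j) * opt_value n j"
proof -
  let ?s = "\<lambda>k. stop3 n (Suc j) k" and ?v = "opt_value n (Suc j)"
  have "(\<Sum>k = 1..Suc j. if ?s k then reward n (Suc j) k else ?v)
      = (\<Sum>k = 1..Suc j. ?v + (if ?s k then reward n (Suc j) k - ?v else 0))"
    by (intro sum.cong) auto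
  also have "\<dots> = real (Suc j) * ?v
      + (\<Sum>k = 1..Suc j. if ?s k then reward n (Suc j) k - ?v else 0)"
    by (simp add: sum.distrib algebra_simps del: sum.cl_ivl_Suc)
  also have "(\<Sum>k = 1..Suc j. if ?s k then reward n (Suc j) k - ?v else 0)
      = (\<Sum>k | k \<in> {1..Suc j} \<and> ?s k. reward n (Suc j) k - ?v)"
    by (rule sum.inter_filter[symmetric]) simp
  also have "real (Suc j) * ?v + \<dots> = real (Suc j) * opt_value n j"
  proof -
    consider "Suc j < a_threshold n" | "a_threshold n \<le> Suc j" "Suc j < b_threshold n"
      | "b_threshold n \<le> Suc j" by linarith
    then show ?thesis
    proof cases
      case 1
      then have "{k. k \<in> {1..Suc j} \<and> ?s k} = {}" using a_threshold_less by (auto simp: stop3_def)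
      moreover have "?v = opt_value n j"
        using 1 opt_value_early[of j] opt_value_early[of "Suc j"] by simp
      ultimately show ?thesis by (simp only: sum.empty)
    next
      case 2
      then have s: "{k. k \<in> {1..Suc j} \<and> ?s k} = {2}" using a_threshold_ge by (auto simp: stop3_def)
      have v: "?v = (real j + 1) * mid_value n (Suc j)"
        using 2 opt_value_mid[of "Suc j"] by simp
      have v': "opt_value n j = real j * (mid_value n (Suc j) + 2 * (real n - real j - 1))"
        using 2 opt_value_mid[of j] mid_step[of j] by simp
      show ?thesis unfolding s v v' by (simp add: reward_def algebra_simps)
    next
      case 3
      then have s: "{k. k \<in> {1..Suc j} \<and> ?s k} = {2, 3}"
        using a_threshold_less b_threshold_ge by (auto simp: stop3_def)
      have v: "?v = (real j + 1) * real j * late_value n (Suc j)"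
        using 3 opt_value_late[of "Suc j"] by simp
      have "opt_value n j = real j * ((real j - 1) * late_value n j)"
        using 3 opt_value_late[of j] by simp
      then have v': "opt_value n j =
          real j * ((real j - 1) * late_value n (Suc j) + (2 * real n - real j - 3))"
        using 3 b_threshold_ge assms by (simp only: late_step)
      show ?thesis unfolding s v v' by (simp add: reward_def algebra_simps)
    qed
  qed
  finally show ?thesis .
qed

lemma opt_value_n: "opt_value n n = 0"
  using b_threshold_le by (simp add: opt_value_late late_value_def tail_sum_def)

end

section \<open>Relative ranks of permutations\<close>

definition rrank :: "(nat \<Rightarrow> nat) \<Rightarrow> nat \<Rightarrow> nat" where
  "rrank r j = card {i \<in> {1..j}. r i \<le> r j}"

text \<open>
  If \<open>x\<close> lists the relative ranks, \<open>running_rank x j i\<close> is the rank of the \<open>j\<close>-th item among the first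
  \<open>i \<ge> j\<close>: a newcomer pushes it back exactly if its own relative rank is at most the current one.
\<close>
fun running_rank :: "(nat \<Rightarrow> nat) \<Rightarrow> nat \<Rightarrow> nat \<Rightarrow> nat" where
  "running_rank x j 0 = x j"
| "running_rank x j (Suc i) =
     (if Suc i \<le> j then x j
      else if x (Suc i) \<le> running_rank x j i then Suc (running_rank x j i)
      else running_rank x j i)"

lemma running_rank_self [simp]: "running_rank x j j = x j"
  by (cases j) auto

lemma running_rank_cong:
  assumes "\<And>l. 1 \<le> l \<Longrightarrow> l \<le> i \<Longrightarrow> x l = z l" "1 \<le> j" "j \<le> i"
  shows "running_rank x j i = running_rank z j i"
  using assms
proof (induction i)
  case (Suc i)
  then show ?case by (cases "j = Suc i") auto
qed simp

lemma running_rank_bounds: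
  assumes "\<And>l. 1 \<le> l \<Longrightarrow> l \<le> i \<Longrightarrow> x l \<in> {1..l}" "1 \<le> j" "j \<le> i"
  shows "running_rank x j i \<in> {1..i}"
  using assms
proof (induction i)
  case (Suc i)
  then show ?case by (cases "j = Suc i") auto
qed simp

lemma rrank_bounds: "1 \<le> j \<Longrightarrow> rrank r j \<in> {1..j}"
proof -
  assume "1 \<le> j"
  have "card {i \<in> {1..j}. r i \<le> r j} \<le> card {1..j}" by (intro card_mono) auto
  moreover have "0 < card {i \<in> {1..j}. r i \<le> r j}"
    using \<open>1 \<le> j\<close> by (subst card_gt_0_iff) auto
  ultimately show ?thesis by (simp add: rrank_def)
qed

text \<open>If the newcomer beats \<open>j\<close>, it counts itself and at most the items of
  \<open>?C\<close> other than \<open>j\<close>, so its relative rank is at most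
  \<open>card ?C\<close>. Otherwise it counts all of \<open>?C\<close> and itself. Injectivity
  excludes ties.\<close>

lemma running_rank_rrank:
  assumes "inj_on r {1..i}" "1 \<le> j" "j \<le> i"
  shows "running_rank (rrank r) j i = card {l \<in> {1..i}. r l \<le> r j}"
  using assms
proof (induction i)
  case (Suc i)
  show ?case
  proof (cases "j = Suc i")
    case True
    then show ?thesis by (simp add: rrank_def)
  next
    case False
    then have ji: "j \<le> i" using Suc.prems by simp
    let ?C = "{l \<in> {1..i}. r l \<le> r j}"
    have IH: "running_rank (rrank r) j i = card ?C"
      using Suc.IH Suc.prems ji inj_on_subset[OF Suc.prems(1), of "{1..i}"] by auto
    have "r (Suc i) \<noteq> r j" using Suc.prems ji by (auto dest: inj_onD)
    then consider "r (Suc i) < r j" | "r j < r (Suc i)" by linarith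
    then show ?thesis
    proof cases
      case 1
      have "{l \<in> {1..Suc i}. r l \<le> r (Suc i)} \<subseteq> insert (Suc i) (?C - {j})"
        using 1 by (auto simp: le_Suc_eq)
      then have "rrank r (Suc i) \<le> card (insert (Suc i) (?C - {j}))"
        unfolding rrank_def by (intro card_mono) auto
      also have "\<dots> \<le> card ?C"
        using ji Suc.prems card_Suc_Diff1[of ?C j] by simp
      finally have "rrank r (Suc i) \<le> card ?C" .
      moreover have "{l \<in> {1..Suc i}. r l \<le> r j} = insert (Suc i) ?C"
        using 1 by (auto simp: le_Suc_eq)
      ultimately show ?thesis using IH False ji by simp
    next
      case 2
      have "insert (Suc i) ?C \<subseteq> {l \<in> {1..Suc i}. r l \<le> r (Suc i)}"
        using 2 by auto
      then have "card (insert (Suc i) ?C) \<le> rrank r (Suc i)"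
        unfolding rrank_def by (intro card_mono) auto
      then have "card ?C < rrank r (Suc i)" by simp
      moreover have "{l \<in> {1..Suc i}. r l \<le> r j} = ?C"
        using 2 by (auto simp: le_Suc_eq)
      ultimately show ?thesis using IH False ji by simp
    qed
  qed
qed simp

text \<open>A permutation takes each value in \<open>{1..p j}\<close> exactly once. Hence the
  relative ranks determine it.\<close>

lemma permutes_rank_eq:
  assumes "p permutes {1..n}" "j \<in> {1..n}"
  shows "running_rank (rrank p) j n = p j"
proof -
  have "p ` {l \<in> {1..n}. p l \<le> p j} = {1..p j}"
  proof (intro equalityI subsetI)
    fix m assume m: "m \<in> {1..p j}"
    have "p j \<in> {1..n}" using permutes_in_image assms by metis
    then have "m \<in> p ` {1..n}" using m permutes_image[OF assms(1)] by auto
    then show "m \<in> p ` {l \<in> {1..n}. p l \<le> p j}" using m by auto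
  next
    fix m assume "m \<in> p ` {l \<in> {1..n}. p l \<le> p j}"
    then show "m \<in> {1..p j}" using permutes_in_image[OF assms(1)] by auto
  qed
  moreover have inj: "inj p" using assms by (auto intro: permutes_inj)
  ultimately have "card {l \<in> {1..n}. p l \<le> p j} = p j"
    by (metis card_atLeastAtMost card_image diff_Suc_1 inj_on_subset subset_UNIV)
  then show ?thesis
    using running_rank_rrank[of p n j] inj assms by (auto intro: inj_on_subset)
qed

lemma rrank_permutation_eqI:
  assumes "p permutes {1..n}" "q permutes {1..n}" "\<And>j. j \<in> {1..n} \<Longrightarrow> rrank p j = rrank q j"
  shows "p = q"
proof
  fix j show "p j = q j"
  proof (cases "j \<in> {1..n}")
    case True
    then have "running_rank (rrank p) j n = running_rank (rrank q) j n"
      using assms(3) by (intro running_rank_cong) auto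
    then show ?thesis using permutes_rank_eq True assms by metis
  next
    case False
    then show ?thesis using assms by (metis permutes_not_in)
  qed
qed

text \<open>By counting: passing to relative ranks is injective on the \<open>n!\<close>
  permutations, and the target has \<open>1 * 2 * ... * n\<close> elements.\<close>

lemma ex_permutation_rrank:
  assumes "\<And>j. j \<in> {1..n} \<Longrightarrow> x j \<in> {1..j}"
  shows "\<exists>p. p permutes {1..n} \<and> (\<forall>j\<in>{1..n}. rrank p j = x j)"
proof -
  let ?P = "{p. p permutes {1..n}}" and ?Q = "\<Pi>\<^sub>E j\<in>{1..n}. {1..j}"
  let ?h = "\<lambda>p. restrict (rrank p) {1..n}"
  have "inj_on ?h ?P"
  proof (rule inj_onI)
    fix p q assume pq: "p \<in> ?P" "q \<in> ?P" "?h p = ?h q"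
    show "p = q"
    proof (rule rrank_permutation_eqI[of p n q])
      show "rrank p j = rrank q j" if "j \<in> {1..n}" for j
        using fun_cong[OF pq(3), of j] that by simp
    qed (use pq in auto)
  qed
  then have "card (?h ` ?P) = card ?P" by (rule card_image)
  also have "\<dots> = fact n" by (rule card_permutations) auto
  also have "\<dots> = card ?Q" by (simp add: card_PiE fact_prod)
  finally have "card (?h ` ?P) = card ?Q" .
  moreover have "?h ` ?P \<subseteq> ?Q" using rrank_bounds by fastforce
  moreover have "finite ?Q" by (intro finite_PiE) auto
  ultimately have "?h ` ?P = ?Q" by (intro card_subset_eq) auto
  moreover have "restrict x {1..n} \<in> ?Q" using assms by auto
  ultimately have "restrict x {1..n} \<in> ?h ` ?P" by simp
  then obtain p where p: "p permutes {1..n}" "restrict x {1..n} = ?h p" by auto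
  have "rrank p j = x j" if "j \<in> {1..n}" for j
    using fun_cong[OF p(2), of j] that by simp
  with p(1) show ?thesis by blast
qed

section \<open>Optimal stopping on cylinders of relative ranks\<close>

locale random_permutation = prob_space M for M :: "'a measure" +
  fixes n :: nat and R :: "nat \<Rightarrow> 'a \<Rightarrow> nat"
  assumes R_measurable: "j \<in> {1..n} \<Longrightarrow> R j \<in> measurable M (count_space UNIV)"
    and R_uniform: "p permutes {1..n} \<Longrightarrow>
      prob {\<omega> \<in> space M. \<forall>j\<in>{1..n}. R j \<omega> = p j} = 1 / fact n"

lemma random_permutation_iff: "uniform_random_permutation M n R \<longleftrightarrow> random_permutation M n R"
  by (auto simp: uniform_random_permutation_def random_permutation_def random_permutation_axioms_def)

lemma rel_rank_eq_rrank: "rel_rank R j \<omega> = rrank (\<lambda>i. R i \<omega>) j"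
  by (simp add: rel_rank_def rrank_def)

lemma rrank_cong: "(\<And>i. i \<in> {1..j} \<Longrightarrow> r i = s i) \<Longrightarrow> 1 \<le> j \<Longrightarrow> rrank r j = rrank s j"
  unfolding rrank_def by (intro arg_cong[where f = card]) auto

context random_permutation
begin

abbreviation (input) "X \<equiv> rel_rank R"
abbreviation (input) "F \<equiv> generated_filtration M X"

text \<open>The nonempty cylinders are the atoms of \<open>F j\<close>, so conditioning on the past
  becomes intersecting with a cylinder.\<close>

definition cyl :: "nat \<Rightarrow> (nat \<Rightarrow> nat) \<Rightarrow> 'a set" where
  "cyl j x = {\<omega> \<in> space M. \<forall>i\<in>{1..j}. X i \<omega> = x i}"

lemma X_measurable [measurable]:
  assumes "j \<in> {1..n}"
  shows "X j \<in> measurable M (count_space UNIV)"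
proof -
  have [measurable]: "R j \<in> measurable M (count_space UNIV)"
    using assms by (rule R_measurable)
  have "{\<omega> \<in> space M. i \<in> {i \<in> {1..j}. R i \<omega> \<le> R j \<omega>}} \<in> sets M" for i
  proof (cases "i \<in> {1..j}")
    case True
    then have [measurable]: "R i \<in> measurable M (count_space UNIV)"
      using assms by (intro R_measurable) auto
    have "{\<omega> \<in> space M. real (R i \<omega>) \<le> real (R j \<omega>)} \<in> sets M" by measurable
    then show ?thesis using True by simp
  next
    case False
    then have "{\<omega> \<in> space M. i \<in> {i \<in> {1..j}. R i \<omega> \<le> R j \<omega>}} = {}" by blast
    then show ?thesis by (simp only: sets.empty_sets)
  qed
  then have "(\<lambda>\<omega>. card {i \<in> {1..j}. R i \<omega> \<le> R j \<omega>}) \<in> measurable M (count_space UNIV)"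
    by (rule measurable_card[where S = "\<lambda>\<omega>. {i \<in> {1..j}. R i \<omega> \<le> R j \<omega>}"])
  moreover have "X j = (\<lambda>\<omega>. card {i \<in> {1..j}. R i \<omega> \<le> R j \<omega>})"
    by (simp add: rel_rank_def fun_eq_iff)
  ultimately show ?thesis by (simp only:)
qed

lemma X_bounds: "1 \<le> j \<Longrightarrow> X j \<omega> \<in> {1..j}"
  unfolding rel_rank_eq_rrank by (rule rrank_bounds)

lemma cyl_Suc_subset: "cyl (Suc j) (x(Suc j := k)) \<subseteq> cyl j x"
proof
  fix \<omega> assume \<omega>: "\<omega> \<in> cyl (Suc j) (x(Suc j := k))"
  have "X i \<omega> = x i" if "i \<in> {1..j}" for i
  proof -
    have "X i \<omega> = (x(Suc j := k)) i" using \<omega> that unfolding cyl_def by auto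
    then show ?thesis using that by simp
  qed
  with \<omega> show "\<omega> \<in> cyl j x" by (simp add: cyl_def)
qed

lemma cyl_sets [measurable]: "j \<le> n \<Longrightarrow> cyl j x \<in> sets M"
  unfolding cyl_def by measurable

section \<open>The law of the relative ranks\<close>

lemma AE_permutation: "AE \<omega> in M. \<exists>p. p permutes {1..n} \<and> (\<forall>j\<in>{1..n}. R j \<omega> = p j)"
proof -
  let ?P = "{p. p permutes {1..n}}"
  let ?E = "\<lambda>p. {\<omega> \<in> space M. \<forall>j\<in>{1..n}. R j \<omega> = p j}"
  have E_sets: "?E p \<in> sets M" for p
  proof -
    have [measurable]: "R j \<in> measurable M (count_space UNIV)" if "j \<in> {1..n}" for j
      using that by (rule R_measurable)
    show ?thesis by measurable
  qed
  \<comment> \<open>There are \<open>n!\<close> disjoint events of probability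
    \<open>1 / n!\<close>, so no mass is left outside the permutations.\<close>
  have "disjoint_family_on ?E ?P"
  proof (unfold disjoint_family_on_def, intro ballI impI)
    fix p q assume pq: "p \<in> ?P" "q \<in> ?P" "p \<noteq> q"
    then obtain j where "p j \<noteq> q j" by auto
    moreover have "j \<in> {1..n}"
      using calculation pq permutes_not_in[of p "{1..n}" j] permutes_not_in[of q "{1..n}" j] by auto
    ultimately show "?E p \<inter> ?E q = {}" by force
  qed
  then have "prob (\<Union>p\<in>?P. ?E p) = (\<Sum>p\<in>?P. prob (?E p))"
    using E_sets by (intro finite_measure_finite_Union) (auto intro: finite_permutations)
  also have "\<dots> = (\<Sum>p\<in>?P. 1 / fact n)"
    by (intro sum.cong R_uniform) auto
  also have "\<dots> = 1"
    using card_permutations[of "{1..n}" n] by (simp del: One_nat_def)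
  finally have "prob (\<Union>p\<in>?P. ?E p) = 1" .
  then have "AE \<omega> in M. \<omega> \<in> (\<Union>p\<in>?P. ?E p)"
    using E_sets by (intro AE_prob_1) auto
  then show ?thesis by eventually_elim auto
qed

lemma AE_running_rank: "AE \<omega> in M. \<forall>j\<in>{1..n}. R j \<omega> = running_rank (\<lambda>i. X i \<omega>) j n"
  using AE_permutation
proof eventually_elim
  case (elim \<omega>)
  then obtain p where p: "p permutes {1..n}" "\<forall>j\<in>{1..n}. R j \<omega> = p j" by blast
  have "X i \<omega> = rrank p i" if "i \<in> {1..n}" for i
    unfolding rel_rank_eq_rrank using p that by (intro rrank_cong) auto
  then have "running_rank (\<lambda>i. X i \<omega>) j n = p j" if "j \<in> {1..n}" for j
    using permutes_rank_eq[OF p(1) that] that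
      running_rank_cong[of n "\<lambda>i. X i \<omega>" "rrank p" j] by auto
  with p show ?case by simp
qed

text \<open>Up to a null set the cylinder is the event that \<open>R\<close> equals the one
  permutation with relative ranks \<open>x\<close>.\<close>

lemma prob_cyl_n:
  assumes "\<And>j. j \<in> {1..n} \<Longrightarrow> x j \<in> {1..j}"
  shows "prob (cyl n x) = 1 / fact n"
proof -
  obtain p where p: "p permutes {1..n}" "\<And>j. j \<in> {1..n} \<Longrightarrow> rrank p j = x j"
    using ex_permutation_rrank[OF assms] by blast
  have [measurable]: "R j \<in> measurable M (count_space UNIV)" if "j \<in> {1..n}" for j
    using that by (rule R_measurable)
  have "prob (cyl n x) = prob {\<omega> \<in> space M. \<forall>j\<in>{1..n}. R j \<omega> = p j}"
  proof (rule finite_measure_eq_AE)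
    show "AE \<omega> in M. \<omega> \<in> cyl n x \<longleftrightarrow> \<omega> \<in> {\<omega> \<in> space M. \<forall>j\<in>{1..n}. R j \<omega> = p j}"
      using AE_running_rank AE_space
    proof eventually_elim
      case (elim \<omega>)
      show ?case
      proof
        assume \<omega>: "\<omega> \<in> cyl n x"
        have "R j \<omega> = p j" if "j \<in> {1..n}" for j
        proof -
          have "R j \<omega> = running_rank (rrank p) j n"
            using elim(1) that \<omega> p(2) running_rank_cong[of n "\<lambda>i. X i \<omega>" "rrank p" j]
            by (auto simp: cyl_def)
          then show ?thesis using permutes_rank_eq[OF p(1) that] by simp
        qed
        then show "\<omega> \<in> {\<omega> \<in> space M. \<forall>j\<in>{1..n}. R j \<omega> = p j}" using elim by simp
      next
        assume \<omega>: "\<omega> \<in> {\<omega> \<in> space M. \<forall>j\<in>{1..n}. R j \<omega> = p j}"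
        have "X i \<omega> = x i" if "i \<in> {1..n}" for i
          unfolding rel_rank_eq_rrank p(2)[OF that, symmetric]
          using \<omega> that by (intro rrank_cong) auto
        then show "\<omega> \<in> cyl n x" using elim by (simp add: cyl_def)
      qed
    qed
  qed (auto intro: cyl_sets)
  with R_uniform[OF p(1)] show ?thesis by simp
qed

lemma prob_cyl_split:
  assumes "j < n" "A \<in> sets M"
  shows "prob (cyl j x \<inter> A) = (\<Sum>k = 1..Suc j. prob (cyl (Suc j) (x(Suc j := k)) \<inter> A))"
proof -
  have eq: "cyl j x \<inter> A = (\<Union>k\<in>{1..Suc j}. cyl (Suc j) (x(Suc j := k)) \<inter> A)"
  proof (intro equalityI subsetI)
    fix \<omega> assume "\<omega> \<in> cyl j x \<inter> A"
    then show "\<omega> \<in> (\<Union>k\<in>{1..Suc j}. cyl (Suc j) (x(Suc j := k)) \<inter> A)"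
      using X_bounds[of "Suc j" \<omega>] by (intro UN_I[of "X (Suc j) \<omega>"]) (auto simp: cyl_def)
  next
    fix \<omega> assume "\<omega> \<in> (\<Union>k\<in>{1..Suc j}. cyl (Suc j) (x(Suc j := k)) \<inter> A)"
    then obtain k where k: "\<omega> \<in> A" "\<omega> \<in> cyl (Suc j) (x(Suc j := k))" by blast
    then show "\<omega> \<in> cyl j x \<inter> A" using cyl_Suc_subset by blast
  qed
  show ?thesis unfolding eq
  proof (rule finite_measure_finite_Union)
    show "(\<lambda>k. cyl (Suc j) (x(Suc j := k)) \<inter> A) ` {1..Suc j} \<subseteq> sets M"
      using assms by (auto intro!: cyl_sets)
    show "disjoint_family_on (\<lambda>k. cyl (Suc j) (x(Suc j := k)) \<inter> A) {1..Suc j}"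
    proof (unfold disjoint_family_on_def, intro ballI impI)
      fix k m :: nat assume "k \<noteq> m"
      have "X (Suc j) \<omega> = l" if "\<omega> \<in> cyl (Suc j) (x(Suc j := l))" for \<omega> l
        using that by (simp add: cyl_def)
      with \<open>k \<noteq> m\<close> show "cyl (Suc j) (x(Suc j := k)) \<inter> A \<inter> (cyl (Suc j) (x(Suc j := m)) \<inter> A) = {}"
        by blast
    qed
  qed simp
qed

text \<open>The case \<open>i = j\<close> justifies \<open>reward\<close>; general \<open>i\<close>
  allows backward induction from \<open>n\<close>, where the running rank is the absolute one. The
  factor \<open>fact i\<close> is the reciprocal of the probability of the cylinder.\<close>

lemma prob_cyl_rank_third:
  assumes n: "3 \<le> n" and j: "1 \<le> j" "j \<le> i" "i \<le> n" and x: "\<And>l. l \<in> {1..i} \<Longrightarrow> x l \<in> {1..l}"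
  shows "real (n * (n - 1) * (n - 2)) * fact i * prob (cyl i x \<inter> {\<omega> \<in> space M. R j \<omega> = 3})
    = reward n i (running_rank x j i)"
proof -
  let ?N = "real (n * (n - 1) * (n - 2))" and ?A = "{\<omega> \<in> space M. R j \<omega> = 3}"
  have [measurable]: "R j \<in> measurable M (count_space UNIV)"
    using j by (intro R_measurable) auto
  have A: "?A \<in> sets M" by measurable
  show ?thesis using j(3,2) x
  proof (induction i arbitrary: x rule: inc_induct)
    case base
    have "AE \<omega> in M. \<omega> \<in> cyl n x \<inter> ?A \<longleftrightarrow> \<omega> \<in> (if running_rank x j n = 3 then cyl n x else {})"
      using AE_running_rank AE_space
    proof eventually_elim
      case (elim \<omega>)
      have "R j \<omega> = running_rank x j n" if "\<omega> \<in> cyl n x"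
        using elim(1) that j running_rank_cong[of n "\<lambda>i. X i \<omega>" x j] by (auto simp: cyl_def)
      then show ?case using elim by auto
    qed
    then have "prob (cyl n x \<inter> ?A) = prob (if running_rank x j n = 3 then cyl n x else {})"
      using A by (intro finite_measure_eq_AE) auto
    moreover have "prob (cyl n x) = 1 / fact n" using base by (intro prob_cyl_n) auto
    ultimately show ?case using n by (simp add: reward_def of_nat_diff)
  next
    case (step i)
    define y where "y = running_rank x j i"
    have y: "y \<in> {1..i}" unfolding y_def using step.prems j by (intro running_rank_bounds) auto
    have rr: "running_rank (x(Suc i := k)) j (Suc i) = (if k \<le> y then Suc y else y)" for k
    proof -
      have "running_rank (x(Suc i := k)) j i = y"
        unfolding y_def using step.prems j by (intro running_rank_cong) auto
      then show ?thesis using step.prems by simp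
    qed
    have "?N * fact (Suc i) * prob (cyl i x \<inter> ?A)
        = (\<Sum>k = 1..Suc i. ?N * fact (Suc i) * prob (cyl (Suc i) (x(Suc i := k)) \<inter> ?A))"
      using prob_cyl_split[OF _ A, of i x] step.hyps
      by (simp add: sum_distrib_left del: sum.cl_ivl_Suc)
    also have "\<dots> = (\<Sum>k = 1..Suc i. reward n (Suc i) (if k \<le> y then Suc y else y))"
    proof (rule sum.cong)
      fix k assume k: "k \<in> {1..Suc i}"
      have "?N * fact (Suc i) * prob (cyl (Suc i) (x(Suc i := k)) \<inter> ?A)
          = reward n (Suc i) (running_rank (x(Suc i := k)) j (Suc i))"
        using step.prems k by (intro step.IH) (auto simp: le_Suc_eq)
      then show "?N * fact (Suc i) * prob (cyl (Suc i) (x(Suc i := k)) \<inter> ?A)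
          = reward n (Suc i) (if k \<le> y then Suc y else y)" by (simp only: rr)
    qed simp
    \<comment> \<open>Of the \<open>i + 1\<close> equally likely newcomers, \<open>y\<close> push
      the item back to rank \<open>y + 1\<close> and the others leave it at
      \<open>y\<close>.\<close>
    also have "\<dots> = (\<Sum>k = 1..y. reward n (Suc i) (Suc y)) + (\<Sum>k = Suc y..Suc i. reward n (Suc i) y)"
    proof -
      have "{1..Suc i} = {1..y} \<union> {Suc y..Suc i}" using y by auto
      then show ?thesis by (simp add: sum.union_disjoint del: sum.cl_ivl_Suc)
    qed
    also have "\<dots> = real y * reward n (Suc i) (Suc y) + (real i + 1 - real y) * reward n (Suc i) y"
      using y by (simp add: of_nat_diff Suc_diff_le)
    also have "\<dots> = real (Suc i) * reward n i y"
    proof -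
      consider "y = 1" | "y = 2" | "y = 3" | "4 \<le> y" using y by force
      then show ?thesis by cases (simp_all add: reward_def algebra_simps)
    qed
    finally have "real (Suc i) * (?N * fact i * prob (cyl i x \<inter> ?A)) = real (Suc i) * reward n i y"
      by (simp add: mult_ac)
    then show ?case unfolding y_def by simp
  qed
qed

section \<open>The filtration of the relative ranks\<close>

lemma space_filtration [simp]: "space (F t) = space M"
  by (simp add: generated_filtration_def space_measure_of_conv)

lemma sets_filtration:
  "sets (F t) = sigma_sets (space M) (\<Union>i\<in>{1..t}. {X i -` A \<inter> space M | A. A \<in> UNIV})"
  unfolding generated_filtration_def by (intro sets_measure_of) auto

lemma sets_filtration_subset: "t \<le> n \<Longrightarrow> sets (F t) \<subseteq> sets M"
  unfolding sets_filtration
  by (intro sets.sigma_sets_subset) (auto intro!: measurable_sets[OF X_measurable])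

lemma X_adapted:
  assumes "i \<in> {1..t}"
  shows "X i \<in> measurable (F t) (count_space UNIV)"
proof (rule measurableI)
  fix A :: "nat set"
  show "X i -` A \<inter> space (F t) \<in> sets (F t)"
    unfolding sets_filtration space_filtration using assms by (intro sigma_sets.Basic) blast
qed simp

text \<open>The generators cannot separate such outcomes, and this passes to complements and
  countable unions.\<close>

lemma filtration_invariant:
  assumes "B \<in> sets (F t)" "\<omega> \<in> space M" "\<omega>' \<in> space M" "\<And>i. i \<in> {1..t} \<Longrightarrow> X i \<omega> = X i \<omega>'"
  shows "\<omega> \<in> B \<longleftrightarrow> \<omega>' \<in> B"
  using assms(1) unfolding sets_filtration
  by (induction rule: sigma_sets.induct) (use assms(2-) in auto)

section \<open>Winning probability of a stopping rule\<close>

definition win :: "('a \<Rightarrow> nat) \<Rightarrow> 'a set" where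
  "win \<tau> = {\<omega> \<in> space M. R (\<tau> \<omega>) \<omega> = 3}"

context
  fixes \<tau> assumes \<tau>: "\<tau> \<in> stopping_rules M n R"
begin

lemma stopping_bounds: "\<omega> \<in> space M \<Longrightarrow> \<tau> \<omega> \<in> {1..n}"
  using \<tau> by (simp add: stopping_rules_def)

lemma stopping_sets: "{\<omega> \<in> space M. \<tau> \<omega> \<le> t} \<in> sets (F t)"
  using \<tau> by (auto simp: stopping_rules_def stopping_time_def pred_def)

text \<open>Reduces a stopping rule to one decision per cylinder, the basis of the upper bound by
  backward induction.\<close>

lemma stopping_invariant:
  assumes "\<omega> \<in> cyl t x" "\<omega>' \<in> cyl t x"
  shows "\<tau> \<omega> \<le> t \<longleftrightarrow> \<tau> \<omega>' \<le> t"
  using filtration_invariant[OF stopping_sets, of \<omega> \<omega>' t] assms by (auto simp: cyl_def)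

lemma stopping_measurable: "{\<omega> \<in> space M. \<tau> \<omega> \<le> t} \<in> sets M"
\<comment> \<open>Beyond \<open>n\<close> the ranks \<open>R j\<close> need not be measurable, but
  there the event is the whole space.\<close>
proof (cases "t \<le> n")
  case True
  then show ?thesis using stopping_sets sets_filtration_subset by blast
next
  case False
  then have "{\<omega> \<in> space M. \<tau> \<omega> \<le> t} = space M" using stopping_bounds by fastforce
  then show ?thesis by simp
qed

lemma win_sets: "win \<tau> \<in> sets M"
proof -
  \<comment> \<open>The event \<open>\<tau> = j\<close> is written as a difference of events
    \<open>\<tau> \<le> t\<close>; \<open>j \<ge> 1\<close> makes \<open>j - 1\<close> a true
    predecessor.\<close>
  have "win \<tau> = (\<Union>j\<in>{1..n}. ({\<omega> \<in> space M. \<tau> \<omega> \<le> j} - {\<omega> \<in> space M. \<tau> \<omega> \<le> j - 1})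
      \<inter> (R j -` {3} \<inter> space M))"
  proof (intro equalityI subsetI)
    fix \<omega> assume "\<omega> \<in> win \<tau>"
    then show "\<omega> \<in> (\<Union>j\<in>{1..n}. ({\<omega> \<in> space M. \<tau> \<omega> \<le> j} - {\<omega> \<in> space M. \<tau> \<omega> \<le> j - 1})
        \<inter> (R j -` {3} \<inter> space M))"
      using stopping_bounds[of \<omega>] by (intro UN_I[of "\<tau> \<omega>"]) (auto simp: win_def)
  next
    fix \<omega> assume "\<omega> \<in> (\<Union>j\<in>{1..n}. ({\<omega> \<in> space M. \<tau> \<omega> \<le> j} - {\<omega> \<in> space M. \<tau> \<omega> \<le> j - 1})
        \<inter> (R j -` {3} \<inter> space M))"
    then obtain j where j: "\<omega> \<in> space M" "\<tau> \<omega> \<le> j" "\<not> \<tau> \<omega> \<le> j - 1" "R j \<omega> = 3" by auto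
    then have "\<tau> \<omega> = j" by simp
    with j show "\<omega> \<in> win \<tau>" by (simp add: win_def)
  qed
  also have "\<dots> \<in> sets M"
  proof (rule sets.finite_UN)
    fix j assume "j \<in> {1..n}"
    then have "R j -` {3} \<inter> space M \<in> sets M"
      by (intro measurable_sets[OF R_measurable]) auto
    with stopping_measurable[of j] stopping_measurable[of "j - 1"]
    show "({\<omega> \<in> space M. \<tau> \<omega> \<le> j} - {\<omega> \<in> space M. \<tau> \<omega> \<le> j - 1})
        \<inter> (R j -` {3} \<inter> space M) \<in> sets M"
      by (rule sets.Int[OF sets.Diff])
  qed simp
  finally show ?thesis .
qed

lemma prob_win_stopped:
  assumes "3 \<le> n" "j \<in> {1..n}" "\<And>l. l \<in> {1..j} \<Longrightarrow> x l \<in> {1..l}"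
    and "\<And>\<omega>. \<omega> \<in> cyl j x \<Longrightarrow> \<tau> \<omega> = j"
  shows "real (n * (n - 1) * (n - 2)) * fact j * prob (cyl j x \<inter> win \<tau>) = reward n j (x j)"
proof -
  have "cyl j x \<inter> win \<tau> = cyl j x \<inter> {\<omega> \<in> space M. R j \<omega> = 3}"
    unfolding win_def using assms(4) by blast
  then show ?thesis using prob_cyl_rank_third[of j j x] assms by simp
qed

lemma prob_win_split:
  assumes "j < n"
  shows "fact (Suc j) * prob (cyl j x \<inter> win \<tau>)
    = (\<Sum>k = 1..Suc j. fact (Suc j) * prob (cyl (Suc j) (x(Suc j := k)) \<inter> win \<tau>))"
  unfolding prob_cyl_split[OF assms win_sets] by (rule sum_distrib_left)


text \<open>Backward induction with a supersolution \<open>v\<close> of the Bellman equation: on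
  each child cylinder the rule either stops everywhere at \<open>j + 1\<close> and earns the reward,
  or goes on everywhere and is bounded by \<open>v (j + 1)\<close>.\<close>

lemma prob_win_le:
  assumes n: "3 \<le> n"
    and v_n: "0 \<le> v n"
    and v_step: "\<And>j. j < n \<Longrightarrow>
      (\<Sum>k = 1..Suc j. max (reward n (Suc j) k) (v (Suc j))) \<le> real (Suc j) * v j"
    and j: "j \<le> n"
    and x: "\<And>l. l \<in> {1..j} \<Longrightarrow> x l \<in> {1..l}"
    and going: "\<And>\<omega>. \<omega> \<in> cyl j x \<Longrightarrow> j < \<tau> \<omega>"
  shows "real (n * (n - 1) * (n - 2)) * fact j * prob (cyl j x \<inter> win \<tau>) \<le> v j"
  using j x going
proof (induction j arbitrary: x rule: inc_induct)
  case base
  \<comment> \<open>No outcome is still running at \<open>n\<close>.\<close>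
  have "cyl n x = {}" using base stopping_bounds by (fastforce simp: cyl_def)
  then show ?case using v_n by simp
next
  case (step j)
  let ?N = "real (n * (n - 1) * (n - 2))" and ?x = "\<lambda>k. x(Suc j := k)"
  have le: "?N * fact (Suc j) * prob (cyl (Suc j) (?x k) \<inter> win \<tau>)
      \<le> max (reward n (Suc j) k) (v (Suc j))" if k: "k \<in> {1..Suc j}" for k
  proof (cases "\<exists>\<omega>0\<in>cyl (Suc j) (?x k). \<tau> \<omega>0 \<le> Suc j")
    case True
    have "\<tau> \<omega> = Suc j" if \<omega>: "\<omega> \<in> cyl (Suc j) (?x k)" for \<omega>
    proof -
      have "\<omega> \<in> cyl j x" using \<omega> cyl_Suc_subset by blast
      moreover have "\<tau> \<omega> \<le> Suc j" using True \<omega> stopping_invariant by blast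
      ultimately show ?thesis using step.prems(2) by fastforce
    qed
    moreover have "?x k l \<in> {1..l}" if "l \<in> {1..Suc j}" for l
      using that k step.prems(1) by (cases "l = Suc j") auto
    ultimately have "?N * fact (Suc j) * prob (cyl (Suc j) (?x k) \<inter> win \<tau>)
          = reward n (Suc j) (?x k (Suc j))"
      using n step.hyps by (intro prob_win_stopped) auto
    then show ?thesis by simp
  next
    case False
    have "?x k l \<in> {1..l}" if "l \<in> {1..Suc j}" for l
      using that k step.prems(1) by (cases "l = Suc j") auto
    then have "?N * fact (Suc j) * prob (cyl (Suc j) (?x k) \<inter> win \<tau>) \<le> v (Suc j)"
      using False by (intro step.IH) (auto simp: not_le simp del: fun_upd_apply)
    then show ?thesis by simp
  qed
  have "real (Suc j) * (?N * fact j * prob (cyl j x \<inter> win \<tau>))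
      = ?N * (fact (Suc j) * prob (cyl j x \<inter> win \<tau>))" by (simp add: mult_ac)
  also have "\<dots> = (\<Sum>k = 1..Suc j. ?N * fact (Suc j) * prob (cyl (Suc j) (?x k) \<inter> win \<tau>))"
    unfolding prob_win_split[OF step.hyps(2)] by (simp only: sum_distrib_left mult.assoc)
  also have "\<dots> \<le> (\<Sum>k = 1..Suc j. max (reward n (Suc j) k) (v (Suc j)))"
    using le by (rule sum_mono)
  also have "\<dots> \<le> real (Suc j) * v j" using v_step step.hyps by simp
  finally show ?case by (simp only: mult_le_cancel_left_pos of_nat_0_less_iff zero_less_Suc)
qed

text \<open>The same induction with equality, for decisions prescribed by \<open>stop\<close>. At
  \<open>n\<close> the rule stops in any case, and \<open>v_n\<close> makes the reward of this
  forced stop equal to \<open>v n\<close>.\<close>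

lemma prob_win_eq:
  assumes n: "3 \<le> n"
    and \<tau>_le: "\<And>t \<omega>. \<omega> \<in> space M \<Longrightarrow> \<tau> \<omega> \<le> t \<longleftrightarrow> n \<le> t \<or> (\<exists>j\<in>{1..t}. stop j (X j \<omega>))"
    and v_n: "\<And>k. \<not> stop n k \<Longrightarrow> reward n n k = v n"
    and v_step: "\<And>j. j < n \<Longrightarrow>
      (\<Sum>k = 1..Suc j. if stop (Suc j) k then reward n (Suc j) k else v (Suc j)) = real (Suc j) * v j"
    and j: "j < n"
    and x: "\<And>l. l \<in> {1..j} \<Longrightarrow> x l \<in> {1..l}"
    and going: "\<And>l. l \<in> {1..j} \<Longrightarrow> \<not> stop l (x l)"
  shows "real (n * (n - 1) * (n - 2)) * fact j * prob (cyl j x \<inter> win \<tau>) = v j"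
  using j x going
proof (induction "n - j" arbitrary: j x)
  case 0
  then show ?case by simp
next
  case (Suc d)
  let ?N = "real (n * (n - 1) * (n - 2))" and ?x = "\<lambda>k. x(Suc j := k)"
  have gt: "j < \<tau> \<omega>" if "\<omega> \<in> cyl j x" for \<omega>
    using \<tau>_le[of \<omega> j] that Suc.prems by (auto simp: cyl_def not_le[symmetric])
  have eq: "?N * fact (Suc j) * prob (cyl (Suc j) (?x k) \<inter> win \<tau>)
      = (if stop (Suc j) k then reward n (Suc j) k else v (Suc j))" if k: "k \<in> {1..Suc j}" for k
  proof -
    have xk: "?x k l \<in> {1..l}" if "l \<in> {1..Suc j}" for l
      using that k Suc.prems(2) by (cases "l = Suc j") auto
    show ?thesis
    proof (cases "stop (Suc j) k \<or> Suc j = n")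
      case True
      have "\<tau> \<omega> = Suc j" if \<omega>: "\<omega> \<in> cyl (Suc j) (?x k)" for \<omega>
      proof -
        have "\<omega> \<in> space M" "X (Suc j) \<omega> = k" using \<omega> by (auto simp: cyl_def)
        then have "\<tau> \<omega> \<le> Suc j" using \<tau>_le[of \<omega> "Suc j"] True by auto
        moreover have "j < \<tau> \<omega>" using gt \<omega> cyl_Suc_subset by blast
        ultimately show ?thesis by simp
      qed
      then have "?N * fact (Suc j) * prob (cyl (Suc j) (?x k) \<inter> win \<tau>)
          = reward n (Suc j) (?x k (Suc j))"
        using n Suc.prems xk by (intro prob_win_stopped) auto
      then show ?thesis using True v_n by auto
    next
      case False
      have "\<not> stop l (?x k l)" if "l \<in> {1..Suc j}" for l
        using that False Suc.prems(3) by (cases "l = Suc j") auto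
      then have "?N * fact (Suc j) * prob (cyl (Suc j) (?x k) \<inter> win \<tau>) = v (Suc j)"
        using False xk Suc.prems Suc.hyps(2) by (intro Suc.hyps(1)) auto
      then show ?thesis using False by simp
    qed
  qed
  have "real (Suc j) * (?N * fact j * prob (cyl j x \<inter> win \<tau>))
      = ?N * (fact (Suc j) * prob (cyl j x \<inter> win \<tau>))" by (simp add: mult_ac)
  also have "\<dots> = (\<Sum>k = 1..Suc j. ?N * fact (Suc j) * prob (cyl (Suc j) (?x k) \<inter> win \<tau>))"
    unfolding prob_win_split[OF Suc.prems(1)] by (simp only: sum_distrib_left mult.assoc)
  also have "\<dots> = (\<Sum>k = 1..Suc j. if stop (Suc j) k then reward n (Suc j) k else v (Suc j))"
    using eq by (intro sum.cong) auto
  also have "\<dots> = real (Suc j) * v j" using v_step Suc.prems by simp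
  finally show ?case by (simp only: mult_cancel_left of_nat_eq_0_iff) simp
qed

end

section \<open>Optimality of the threshold rule\<close>

lemma prob_select_third_eq: "prob_select_third M R \<tau> = prob (win \<tau>)"
  by (simp add: prob_select_third_def win_def)

lemma cyl_0 [simp]: "cyl 0 x = space M"
  by (simp add: cyl_def)

text \<open>Evaluates the general bound at the empty history; \<open>stop3\<close> picks the larger
  of reward and continuation value.\<close>

lemma prob_select_third_le:
  assumes n: "3 \<le> n" and \<tau>: "\<tau> \<in> stopping_rules M n R"
  shows "real (n * (n - 1) * (n - 2)) * prob_select_third M R \<tau> \<le> opt_value n 0"
proof -
  have "real (n * (n - 1) * (n - 2)) * fact 0 * prob (cyl 0 x \<inter> win \<tau>) \<le> opt_value n 0" for x
  proof (rule prob_win_le[OF \<tau> n])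
    fix j assume j: "j < n"
    have "max (reward n (Suc j) k) (opt_value n (Suc j))
        = (if stop3 n (Suc j) k then reward n (Suc j) k else opt_value n (Suc j))" for k
      using reward_le_opt_value[OF n, of "Suc j" k] opt_value_le_reward[OF n, of "Suc j" k] j
      by (auto simp: max_def)
    then show "(\<Sum>k = 1..Suc j. max (reward n (Suc j) k) (opt_value n (Suc j)))
        \<le> real (Suc j) * opt_value n j"
      using opt_value_step[OF n j] by (simp only: order_refl)
  qed (use n stopping_bounds[OF \<tau>] in \<open>auto simp: opt_value_n cyl_def Suc_le_eq\<close>)
  moreover have "space M \<inter> win \<tau> = win \<tau>" by (auto simp: win_def)
  ultimately show ?thesis by (simp add: prob_select_third_eq)
qed

lemma min_or_le:
  assumes "finite S"
  shows "min_or m S \<le> t \<longleftrightarrow> S = {} \<and> m \<le> t \<or> (\<exists>j\<in>S. j \<le> t)"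
  using assms by (auto simp: min_or_def Min_le_iff)

text \<open>The disjunct \<open>n \<le> t\<close> reflects the value \<open>n\<close> of an empty
  minimum; thresholds of at least 2 make \<open>j \<ge> 1\<close> automatic.\<close>

lemma tau3_le:
  assumes n: "3 \<le> n"
  shows "tau3 n R \<omega> \<le> t \<longleftrightarrow> n \<le> t \<or> (\<exists>j\<in>{1..t}. stop3 n j (X j \<omega>))"
proof (cases "n \<le> t")
  case True
  then show ?thesis by (auto simp: tau3_def min_le_iff_disj min_or_le)
next
  case False
  then show ?thesis using a_threshold_ge[OF n] b_threshold_ge[OF n]
    unfolding tau3_def min_le_iff_disj by (force simp: min_or_le stop3_def)
qed

lemma tau3_stopping_rule:
  assumes n: "3 \<le> n"
  shows "tau3 n R \<in> stopping_rules M n R"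
proof -
  have "Measurable.pred (F t) (\<lambda>\<omega>. tau3 n R \<omega> \<le> t)" for t
  proof -
    have [measurable]: "X j \<in> measurable (F t) (count_space UNIV)" if "j \<in> {1..t}" for j
      using that by (rule X_adapted)
    show ?thesis unfolding tau3_le[OF n] by measurable
  qed
  moreover have "tau3 n R \<omega> \<in> {1..n}" for \<omega>
    using tau3_le[OF n, of \<omega> 0] tau3_le[OF n, of \<omega> n] n by auto
  ultimately show ?thesis by (auto simp: stopping_rules_def stopping_time_def)
qed

lemma prob_select_third_tau3:
  assumes n: "3 \<le> n"
  shows "real (n * (n - 1) * (n - 2)) * prob_select_third M R (tau3 n R) = opt_value n 0"
proof -
  have "real (n * (n - 1) * (n - 2)) * fact 0 * prob (cyl 0 x \<inter> win (tau3 n R)) = opt_value n 0"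
    for x
  proof (rule prob_win_eq[OF tau3_stopping_rule[OF n] n, where stop = "stop3 n"])
    fix k assume "\<not> stop3 n n k"
    \<comment> \<open>Rank 3 is always accepted at \<open>n\<close> because
      \<open>b \<le> n\<close>, and all other ranks earn 0 there.\<close>
    then have "k \<noteq> 3" using b_threshold_le[OF n] by (auto simp: stop3_def)
    then show "reward n n k = opt_value n n" by (simp add: reward_def opt_value_n[OF n])
  qed (use n tau3_le[OF n] opt_value_step[OF n] in auto)
  moreover have "space M \<inter> win (tau3 n R) = win (tau3 n R)" by (auto simp: win_def)
  ultimately show ?thesis by (simp add: prob_select_third_eq)
qed

end

theorem theorem2p1:
  fixes n :: nat
  assumes "n \<ge> 3"
  shows "a_threshold n < b_threshold n \<and>
    (\<forall>(M :: 'a measure) R. uniform_random_permutation M n R \<longrightarrow>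
       tau3 n R \<in> stopping_rules M n R \<and>
       prob_select_third M R (tau3 n R) =
         (SUP \<tau>\<in>stopping_rules M n R. prob_select_third M R \<tau>))"
proof (intro conjI allI impI)
  show "a_threshold n < b_threshold n" using assms by (rule a_threshold_less)
next
  fix M :: "'a measure" and R
  assume "uniform_random_permutation M n R"
  then interpret random_permutation M n R by (simp add: random_permutation_iff)
  show mem: "tau3 n R \<in> stopping_rules M n R" using assms by (rule tau3_stopping_rule)
  have "prob_select_third M R \<tau> \<le> prob_select_third M R (tau3 n R)"
    if "\<tau> \<in> stopping_rules M n R" for \<tau>
  proof -
    have "real (n * (n - 1) * (n - 2)) * prob_select_third M R \<tau>
        \<le> real (n * (n - 1) * (n - 2)) * prob_select_third M R (tau3 n R)"
      using prob_select_third_le[OF assms that] prob_select_third_tau3[OF assms] by simp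
    moreover have "0 < real (n * (n - 1) * (n - 2))" using assms by simp
    ultimately show ?thesis by (simp only: mult_le_cancel_left_pos)
  qed
  then show "prob_select_third M R (tau3 n R)
      = (SUP \<tau>\<in>stopping_rules M n R. prob_select_third M R \<tau>)"
    using mem by (intro cSup_eq_maximum[symmetric]) auto
qed

end
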